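(* Let $\lambda_1,\lambda_2 \in \mathbb{N}$ be two coprime positive integers and let $S=\{0,\lambda_1,\lambda_1+\lambda_2\}$. Then \[ d_f(S,-S)=d_f(S)= \max \left (\frac{\lfloor \frac{2}{3}( \lambda_1+2\lambda_2)\rfloor}{\lambda_1+2\lambda_2},\frac{\lfloor \frac{2}{3}( 2\lambda_1+\lambda_2)\rfloor}{2\lambda_1+\lambda_2}\right). \]
   Context: For $A\subset\mathbb{Z}$, the upper density is $\overline{d}(A)=\limsup_{n\to\infty}\frac{|A\cap[-n,n]|}{2n+1}$. For $S\subset\mathbb{Z}$, a translate of $S$ is a set $S+t=\{s+t:s\in S\}$ with $t\in\mathbb{Z}$, and $-S=\{-s:s\in S\}$. A set $A\subset\mathbb{Z}$ is $S$-free if it contains no translate of $S$. $d_f(S)$ is the supremum of $\overline{d}(A)$ over all $S$-free sets $A\subset\mathbb{Z}$, and $d_f(S,-S)$ is the supremum of $\overline{d}(A)$ over all sets $A\subset\mathbb{Z}$ that contain no translate of $S$ and no translate of $-S$. *)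

theory Defs
  imports "HOL-Analysis.Analysis"
begin

text \<open>
  Densities are extended reals, so that the limit superior and the suprema
  below are those of a complete lattice. For nonempty sets the suprema range
  over a nonempty family (it contains the empty set) of values between 0 and 1.
\<close>

definition upper_density :: "int set \<Rightarrow> ereal" where
  "upper_density A =
     limsup (\<lambda>n::nat. ereal (real (card (A \<inter> {- int n..int n})) / (2 * real n + 1)))"

definition translate :: "int set \<Rightarrow> int \<Rightarrow> int set" where
  "translate S t = (\<lambda>s. s + t) ` S"

definition is_free :: "int set \<Rightarrow> int set \<Rightarrow> bool" where
  "is_free S A \<longleftrightarrow> (\<nexists>t. translate S t \<subseteq> A)"

definition d_f :: "int set \<Rightarrow> ereal" where
  "d_f S = (SUP A\<in>{A. is_free S A}. upper_density A)"

definition d_f2 :: "int set \<Rightarrow> int set \<Rightarrow> ereal" where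
  "d_f2 S T = (SUP A\<in>{A. is_free S A \<and> is_free T A}. upper_density A)"

end

theory Submission
  imports Defs
begin

text \<open>
  Write \<open>a, b\<close> for \<open>\<lambda>\<^sub>1, \<lambda>\<^sub>2\<close> and let \<open>f\<close> be the indicator function of the complement of a free set. View
  the integer \<open>a x + b y\<close> as the point \<open>(x, y)\<close> of a triangular lattice rolled up along \<open>(b, - a)\<close>;
  then \<open>f\<close> hits every triangle \<open>{t, t + a, t + a + b}\<close>, and the excess \<open>f t + f (t + a) + f (t + a + b) - 1\<close>
  vanishes on average only for the 3-colouring of the lattice, which is incompatible with the
  period unless \<open>a \<equiv> b (mod 3)\<close>. To quantify this, colour \<open>\<int>\<close> by a function \<open>H\<close> into \<open>\<int>/3\<close>, determined by
  \<open>f\<close> locally, which increases by 1 along steps \<open>a\<close> and \<open>b\<close> wherever \<open>f\<close> looks like the 3-colouring. The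
  defects of \<open>H\<close> along a loop around the cylinder add up to \<open>a - b\<close> modulo 3, and suitably weighted
  they are, on average, at most 4 times (steps \<open>a\<close>) and 2 times (steps \<open>b\<close>) the excess. A loop consists of
  \<open>b\<close> steps \<open>a\<close> and \<open>a\<close> steps \<open>- b\<close>, so if \<open>a - b \<equiv> 2 (mod 3)\<close> then \<open>2 \<le> (4 b + 2 a) E\<close> for the mean excess \<open>E\<close>,
  which is the bound for \<open>n = a + 2 b\<close>. The case \<open>a - b \<equiv> 1\<close> follows by reflection.
  Conversely, \<open>S\<close> and \<open>- S\<close> are 3-term progressions modulo both \<open>a + 2 b\<close> and \<open>2 a + b\<close>.
\<close>

section \<open>Interval sums bounded above\<close>

text \<open>An integer form of "the mean of \<open>F\<close> is at most 0" with error O(1) per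
  interval. Such statements can be added and scaled, and limits enter only at the end.\<close>

definition sums_bdd_above :: "(int \<Rightarrow> int) \<Rightarrow> bool" where
  "sums_bdd_above F \<longleftrightarrow> (\<exists>C. \<forall>m n. (\<Sum>i\<in>{m..<n}. F i) \<le> C)"

lemma sums_bdd_aboveI_nonpos:
  assumes "\<And>i. F i \<le> 0"
  shows "sums_bdd_above F"
  unfolding sums_bdd_above_def using assms by (intro exI[of _ 0]) (simp add: sum_nonpos)

lemma sums_bdd_above_add:
  assumes "sums_bdd_above F" "sums_bdd_above G"
  shows "sums_bdd_above (\<lambda>i. F i + G i)"
proof -
  from assms obtain C D where "\<And>m n. (\<Sum>i\<in>{m..<n}. F i) \<le> C" "\<And>m n. (\<Sum>i\<in>{m..<n}. G i) \<le> D"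
    unfolding sums_bdd_above_def by blast
  then have "(\<Sum>i\<in>{m..<n}. F i + G i) \<le> C + D" for m n
    unfolding sum.distrib by (intro add_mono)
  then show ?thesis
    unfolding sums_bdd_above_def by blast
qed

lemma sums_bdd_above_cmult:
  assumes "sums_bdd_above F" "c \<ge> 0"
  shows "sums_bdd_above (\<lambda>i. c * F i)"
proof -
  from assms obtain C where "\<And>m n. (\<Sum>i\<in>{m..<n}. F i) \<le> C"
    unfolding sums_bdd_above_def by blast
  then have "(\<Sum>i\<in>{m..<n}. c * F i) \<le> c * C" for m n
    using \<open>c \<ge> 0\<close> by (simp add: sum_distrib_left[symmetric] mult_left_mono)
  then show ?thesis
    unfolding sums_bdd_above_def by blast
qed

lemma sums_bdd_above_cancel:
  assumes "sums_bdd_above (\<lambda>i. c * F i)" "c > 0"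
  shows "sums_bdd_above F"
proof -
  from assms obtain C where C: "\<And>m n. (\<Sum>i\<in>{m..<n}. c * F i) \<le> C"
    unfolding sums_bdd_above_def by blast
  have "(\<Sum>i\<in>{m..<n}. F i) \<le> C div c" for m n
    using zdiv_mono1[OF C[of m n] \<open>c > 0\<close>] \<open>c > 0\<close>
    by (simp add: sum_distrib_left[symmetric])
  then show ?thesis
    unfolding sums_bdd_above_def by blast
qed

lemma sums_bdd_above_sum:
  assumes "finite J" "\<And>j. j \<in> J \<Longrightarrow> sums_bdd_above (F j)"
  shows "sums_bdd_above (\<lambda>i. \<Sum>j\<in>J. F j i)"
  using assms
  by (induction J rule: finite_induct) (auto intro: sums_bdd_aboveI_nonpos sums_bdd_above_add)

lemma sums_bdd_above_mono:
  assumes "sums_bdd_above G" "\<And>i. F i \<le> G i"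
  shows "sums_bdd_above F"
  using sums_bdd_above_add[OF assms(1) sums_bdd_aboveI_nonpos[of "\<lambda>i. F i - G i"]] assms(2)
  by simp

text \<open>A unit shift telescopes to a difference of two boundary values; larger \<open>c\<close>
  chain unit shifts. Hence a bounded function may be translated freely inside a mean.\<close>

lemma sums_bdd_above_shift:
  fixes g :: "int \<Rightarrow> int" and c :: int
  assumes "\<And>i. \<bar>g i\<bar> \<le> K" "c \<ge> 0"
  shows "sums_bdd_above (\<lambda>i. g (i + c) - g i)"
proof -
  have K: "K \<ge> 0"
    using assms(1)[of 0] by linarith
  have unit: "sums_bdd_above (\<lambda>i. h (i + 1) - h i)" if h: "\<And>i. \<bar>h i\<bar> \<le> K" for h :: "int \<Rightarrow> int"
  proof -
    have "(\<Sum>i\<in>{m..<n}. h (i + 1) - h i) \<le> 2 * K" for m n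
    proof (cases "m \<le> n")
      case True
      then have "(\<Sum>i\<in>{m..<n}. h (i + 1) - h i) = h n - h m"
      proof (induction n rule: int_ge_induct)
        case (step n)
        then have "{m..<n + 1} = insert n {m..<n}" by auto
        with step show ?case by simp
      qed simp
      with h[of n] h[of m] show ?thesis by linarith
    qed (use K in simp)
    then show ?thesis
      unfolding sums_bdd_above_def by blast
  qed
  have "sums_bdd_above (\<lambda>i. g (i + int k) - g i)" for k
  proof (induction k)
    case 0
    then show ?case by (auto intro: sums_bdd_aboveI_nonpos)
  next
    case (Suc k)
    from sums_bdd_above_add[OF Suc unit[of "\<lambda>i. g (i + int k)"]] assms(1)
    show ?case by (simp add: algebra_simps)
  qed
  from this[of "nat c"] \<open>c \<ge> 0\<close> show ?thesis by simp
qed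

lemma sums_bdd_above_shift':
  fixes g :: "int \<Rightarrow> int" and c :: int
  assumes "\<And>i. \<bar>g i\<bar> \<le> K" "c \<ge> 0"
  shows "sums_bdd_above (\<lambda>i. g i - g (i + c))"
  using sums_bdd_above_shift[of "\<lambda>i. - g i" K c] assms by simp

section \<open>From interval sums to upper density\<close>

lemma sum_of_bool_window:
  "(\<Sum>i\<in>{- int N..<int N + 1}. q * of_bool (i \<in> A) - p) =
     q * int (card (A \<inter> {- int N..int N})) - p * (2 * int N + 1)"
proof -
  have *: "{- int N..<int N + 1} = {- int N..int N}" by auto
  show ?thesis
    unfolding * by (simp add: sum_subtractf sum_distrib_left[symmetric] Int_commute
        Collect_conj_eq mult.commute)
qed

lemma tendsto_const_plus_inverse_window:
  "(\<lambda>N::nat. ereal (x + y / (2 * real N + 1))) \<longlonglongrightarrow> ereal x"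
proof -
  have "(\<lambda>N::nat. x + y / (2 * real N + 1)) \<longlonglongrightarrow> x + 0"
    by (intro tendsto_intros real_tendsto_divide_at_top[OF tendsto_const]
        filterlim_at_top_mono[OF filterlim_real_sequentially] always_eventually) auto
  then show ?thesis by simp
qed

lemma upper_density_le:
  assumes "sums_bdd_above (\<lambda>i. q * of_bool (i \<in> A) - p)" "q > 0"
  shows "upper_density A \<le> ereal (real_of_int p / real_of_int q)"
proof -
  from assms(1) obtain C where C: "\<And>m n. (\<Sum>i\<in>{m..<n}. q * of_bool (i \<in> A) - p) \<le> C"
    unfolding sums_bdd_above_def by blast
  have le: "real (card (A \<inter> {- int N..int N})) / (2 * real N + 1) \<le>
      p / q + (C / q) / (2 * real N + 1)" for N
  proof -
    have "q * int (card (A \<inter> {- int N..int N})) \<le> p * (2 * int N + 1) + C"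
      using C[of "- int N" "int N + 1"] unfolding sum_of_bool_window by linarith
    then have "real_of_int (q * int (card (A \<inter> {- int N..int N}))) \<le>
        real_of_int (p * (2 * int N + 1) + C)"
      by (simp only: of_int_le_iff)
    then have "real (card (A \<inter> {- int N..int N})) \<le> p / q * (2 * real N + 1) + C / q"
      using \<open>q > 0\<close> by (simp add: field_simps)
    then show ?thesis
      by (simp add: pos_divide_le_eq distrib_right)
  qed
  have "upper_density A \<le> limsup (\<lambda>N::nat. ereal (p / q + (C / q) / (2 * real N + 1)))"
    unfolding upper_density_def by (intro Limsup_mono always_eventually allI) (simp only: ereal_less_eq le)
  also have "\<dots> = ereal (p / q)"
    by (intro lim_imp_Limsup tendsto_const_plus_inverse_window) simp
  finally show ?thesis .
qed

lemma upper_density_ge: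
  assumes "sums_bdd_above (\<lambda>i. p - q * of_bool (i \<in> A))" "q > 0"
  shows "ereal (real_of_int p / real_of_int q) \<le> upper_density A"
proof -
  from assms(1) obtain C where C: "\<And>m n. (\<Sum>i\<in>{m..<n}. p - q * of_bool (i \<in> A)) \<le> C"
    unfolding sums_bdd_above_def by blast
  have le: "p / q + (- C / q) / (2 * real N + 1) \<le>
      real (card (A \<inter> {- int N..int N})) / (2 * real N + 1)" for N
  proof -
    have "p * (2 * int N + 1) - C \<le> q * int (card (A \<inter> {- int N..int N}))"
      using C[of "- int N" "int N + 1"] sum_of_bool_window[of "- q" A "- p" N] by simp
    then have "real_of_int (p * (2 * int N + 1) - C) \<le>
        real_of_int (q * int (card (A \<inter> {- int N..int N})))"
      by (simp only: of_int_le_iff)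
    then have "(p * (2 * real N + 1) - C) / q \<le> real (card (A \<inter> {- int N..int N}))"
      using \<open>q > 0\<close> by (simp add: pos_divide_le_eq mult.commute)
    then show ?thesis
      by (simp add: pos_le_divide_eq left_diff_distrib diff_divide_distrib)
  qed
  have "ereal (p / q) = limsup (\<lambda>N::nat. ereal (p / q + (- C / q) / (2 * real N + 1)))"
    by (intro lim_imp_Limsup[symmetric] tendsto_const_plus_inverse_window) simp
  also have "\<dots> \<le> upper_density A"
    unfolding upper_density_def by (intro Limsup_mono always_eventually allI) (simp only: ereal_less_eq le)
  finally show ?thesis .
qed

lemma upper_density_uminus: "upper_density (uminus ` A) = upper_density A"
proof -
  have "uminus ` A \<inter> {- int N..int N} = uminus ` (A \<inter> {- int N..int N})" for N
    by force
  then have "card (uminus ` A \<inter> {- int N..int N}) = card (A \<inter> {- int N..int N})" for N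
    by (simp add: card_image)
  then show ?thesis
    unfolding upper_density_def by simp
qed

section \<open>Free sets and reflection\<close>

lemma is_free_triple_iff:
  "is_free {0, a, a + b} A \<longleftrightarrow> (\<forall>t. \<not> (t \<in> A \<and> t + a \<in> A \<and> t + a + b \<in> A))"
  unfolding is_free_def translate_def by (simp add: algebra_simps)

lemma is_free_uminus_triple_iff:
  "is_free (uminus ` {0, a, a + b}) A \<longleftrightarrow> (\<forall>t. \<not> (t \<in> A \<and> t - a \<in> A \<and> t - a - b \<in> A))"
  unfolding is_free_def translate_def by (simp add: algebra_simps)

text \<open>Negation reverses the order of the gaps \<open>a\<close> and \<open>b\<close>; this
  reduces \<open>a - b \<equiv> 1 (mod 3)\<close> to residue 2.\<close>

lemma is_free_triple_reflect:
  assumes "is_free {0, a, a + b} A"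
  shows "is_free {0, b, b + a} (uminus ` A)"
proof -
  have uminus_mem: "x \<in> uminus ` A \<longleftrightarrow> - x \<in> A" for x
    by force
  have "\<not> (- t \<in> A \<and> - (t + b) \<in> A \<and> - (t + b + a) \<in> A)" for t
    using assms[unfolded is_free_triple_iff, rule_format, of "- (t + b + a)"] by auto
  then show ?thesis
    unfolding is_free_triple_iff uminus_mem by blast
qed

section \<open>Upper bound from colouring defects\<close>

text \<open>
  The loop based at \<open>t\<close> moves by \<open>a\<close> from points below \<open>t + b\<close> and by \<open>- b\<close> from the others, and so visits
  exactly the integers in \<open>[t, t + a + b)\<close>.
\<close>

lemma sum_mod_3_telescope:
  fixes H :: "int \<Rightarrow> int" and t :: int and a b :: nat
  shows "((\<Sum>i<b. (H (t + i + a) - H (t + i) - 1) mod 3) +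
          (\<Sum>i<a. (1 + H (t + i) - H (t + i + b)) mod 3)) mod 3 = (int a - int b) mod 3"
proof -
  \<comment> \<open>The sum of \<open>H\<close> over \<open>[t, t + a + b)\<close> is split at
    \<open>t + a\<close> and at \<open>t + b\<close>, so that all values of \<open>H\<close>
    cancel.\<close>
  have split: "(\<Sum>i<m + n. H (t + int i)) = (\<Sum>i<m. H (t + int i)) + (\<Sum>i<n. H (t + int i + int m))"
    for m n :: nat
    by (induction n) (simp_all add: algebra_simps)
  let ?A = "\<lambda>i::nat. H (t + i + a) - H (t + i) - 1" and ?B = "\<lambda>i::nat. 1 + H (t + i) - H (t + i + b)"
  have "(\<Sum>i<b. ?A i) + (\<Sum>i<a. ?B i) = int a - int b"
    using split[of a b] split[of b a]
    by (simp add: sum_subtractf sum.distrib add.commute)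
  moreover have "((\<Sum>i<b. ?A i mod 3) + (\<Sum>i<a. ?B i mod 3)) mod 3 =
      ((\<Sum>i<b. ?A i mod 3) mod 3 + (\<Sum>i<a. ?B i mod 3) mod 3) mod 3"
    by (simp only: mod_add_eq)
  then have "((\<Sum>i<b. ?A i mod 3) + (\<Sum>i<a. ?B i mod 3)) mod 3 =
      ((\<Sum>i<b. ?A i) + (\<Sum>i<a. ?B i)) mod 3"
    by (simp only: mod_sum_eq mod_add_eq)
  ultimately show ?thesis
    by (simp only:)
qed

lemma free_density_bound:
  fixes a b :: nat
  assumes free: "is_free {0, int a, int a + int b} A" and mod: "(int a - int b) mod 3 = 2"
  shows "sums_bdd_above (\<lambda>i. 3 * (int a + 2 * int b) * of_bool (i \<in> A) - (2 * (int a + 2 * int b) - 1))"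
proof -
  define f :: "int \<Rightarrow> int" where "f i = of_bool (i \<notin> A)" for i
  \<comment> \<open>In the perfect 3-colouring the complement of \<open>A\<close> has colour 0, its
    translate by \<open>- a\<close> colour 2 and the rest colour 1. Where \<open>i\<close> and
    \<open>i + a\<close> are both missing from \<open>A\<close>, 2 takes precedence over 0.\<close>
  define H :: "int \<Rightarrow> int" where "H i = (if i + int a \<notin> A then 2 else if i \<notin> A then 0 else 1)" for i
  \<comment> \<open>Defects along the steps \<open>a\<close> from \<open>i\<close> and
    \<open>- b\<close> from \<open>i + b\<close>, as least nonnegative residues.\<close>
  define W1 where "W1 i = (H (i + int a) - H i - 1) mod 3" for i
  define W2 where "W2 i = (1 + H i - H (i + int b)) mod 3" for i
  define p where "p i = f i * f (i + int a)" for i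
  define q where "q i = f i * f (i + int b)" for i
  define r where "r i = f (i + int a) * f (i + int b)" for i
  \<comment> \<open>The telescoping terms in the two pointwise bounds below were found by linear programming.\<close>
  have bd: "\<bar>f i\<bar> \<le> 1" "\<bar>p i\<bar> \<le> 1" "\<bar>q i\<bar> \<le> 1" "\<bar>r i\<bar> \<le> 1" for i
    by (simp_all add: f_def p_def q_def r_def)
  have hit: "i \<notin> A \<or> i + int a \<notin> A \<or> i + int a + int b \<notin> A" for i
    using free unfolding is_free_triple_iff by blast
  note shifts = sums_bdd_above_shift[OF bd(1)] sums_bdd_above_shift'[OF bd(1)]
    sums_bdd_above_shift[OF bd(2)] sums_bdd_above_shift'[OF bd(2)]
    sums_bdd_above_shift[OF bd(3)] sums_bdd_above_shift'[OF bd(3)]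
    sums_bdd_above_shift[OF bd(4)] sums_bdd_above_shift'[OF bd(4)]
  \<comment> \<open>Translation leaves means unchanged, so \<open>3 * f i - 1\<close> has the mean
    of the excess.\<close>
  have W1: "sums_bdd_above (\<lambda>i. W1 i - 4 * (3 * f i - 1))"
  proof (rule sums_bdd_above_mono)
    show "sums_bdd_above (\<lambda>i. 4 * (f (i + int a) - f i) + (6 * (f (i + (int a + int b)) - f i)
       + (3 * (f i - f (i + int b)) + ((f (i + 2 * int a) - f i)
       + ((p (i + int a) - p i) + (3 * (p (i + int b) - p i)
       + (3 * (q i - q (i + int a)) + 3 * (r i - r (i + int a)))))))))"
      by (intro sums_bdd_above_add sums_bdd_above_cmult shifts) simp_all
    show "W1 i - 4 * (3 * f i - 1) \<le> 4 * (f (i + int a) - f i) + (6 * (f (i + (int a + int b)) - f i)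
       + (3 * (f i - f (i + int b)) + ((f (i + 2 * int a) - f i)
       + ((p (i + int a) - p i) + (3 * (p (i + int b) - p i)
       + (3 * (q i - q (i + int a)) + 3 * (r i - r (i + int a))))))))" for i
    proof -
      have eq: "i + (int a + int b) = i + int a + int b" "i + int b + int a = i + int a + int b"
        "i + 2 * int a = i + int a + int a" by simp_all
      show ?thesis
        unfolding W1_def p_def q_def r_def eq H_def f_def using hit[of i] hit[of "i + int a"]
        by (cases "i \<in> A"; cases "i + int a \<in> A"; cases "i + int a + int a \<in> A";
            cases "i + int b \<in> A"; cases "i + int a + int b \<in> A"; simp)
    qed
  qed
  have W2: "sums_bdd_above (\<lambda>i. W2 i - 2 * (3 * f i - 1))"
  proof (rule sums_bdd_above_mono)
    show "sums_bdd_above (\<lambda>i. 4 * (f (i + int a) - f i) + (2 * (f (i + (int a + int b)) - f i)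
       + (2 * (f i - f (i + int b)) + (2 * (p (i + int b) - p i) + 3 * (q i - q (i + int a))))))"
      by (intro sums_bdd_above_add sums_bdd_above_cmult shifts) simp_all
    show "W2 i - 2 * (3 * f i - 1) \<le> 4 * (f (i + int a) - f i) + (2 * (f (i + (int a + int b)) - f i)
       + (2 * (f i - f (i + int b)) + (2 * (p (i + int b) - p i) + 3 * (q i - q (i + int a)))))" for i
    proof -
      have eq: "i + (int a + int b) = i + int a + int b" "i + int b + int a = i + int a + int b"
        by simp_all
      show ?thesis
        unfolding W2_def p_def q_def eq H_def f_def using hit[of i]
        by (cases "i \<in> A"; cases "i + int a \<in> A";
            cases "i + int b \<in> A"; cases "i + int a + int b \<in> A"; simp)
    qed
  qed
  have 1: "sums_bdd_above (\<lambda>i. W1 (i + int j) - 4 * (3 * f i - 1))" for j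
  proof -
    have "\<bar>W1 i\<bar> \<le> 3" for i
      unfolding W1_def by (simp add: less_imp_le)
    then have "sums_bdd_above (\<lambda>i. W1 (i + int j) - W1 i)"
      by (intro sums_bdd_above_shift) simp_all
    from sums_bdd_above_add[OF this W1] show ?thesis by (simp add: algebra_simps)
  qed
  have 2: "sums_bdd_above (\<lambda>i. W2 (i + int j) - 2 * (3 * f i - 1))" for j
  proof -
    have "\<bar>W2 i\<bar> \<le> 3" for i
      unfolding W2_def by (simp add: less_imp_le)
    then have "sums_bdd_above (\<lambda>i. W2 (i + int j) - W2 i)"
      by (intro sums_bdd_above_shift) simp_all
    from sums_bdd_above_add[OF this W2] show ?thesis by (simp add: algebra_simps)
  qed
  \<comment> \<open>The defects are nonnegative, so a total of residue 2 is at least 2.\<close>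
  have loop: "2 \<le> (\<Sum>j<b. W1 (i + int j)) + (\<Sum>j<a. W2 (i + int j))" for i
  proof -
    let ?s = "(\<Sum>j<b. W1 (i + int j)) + (\<Sum>j<a. W2 (i + int j))"
    have "?s mod 3 = 2"
      using sum_mod_3_telescope[where a = a and b = b and H = H and t = i] mod
      by (simp add: W1_def W2_def)
    moreover have "?s \<ge> 0"
      by (intro add_nonneg_nonneg sum_nonneg) (simp_all add: W1_def W2_def)
    ultimately show ?thesis
      by presburger
  qed
  have "sums_bdd_above (\<lambda>i. (\<Sum>j<b. W1 (i + int j) - 4 * (3 * f i - 1)) +
      (\<Sum>j<a. W2 (i + int j) - 2 * (3 * f i - 1)))"
    by (intro sums_bdd_above_add sums_bdd_above_sum 1 2) simp_all
  \<comment> \<open>The rates 4 and 2 add up to \<open>4 b + 2 a = 2 (a + 2 b)\<close>, and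
    \<open>3 * f i - 1 = 2 - 3 * of_bool (i \<in> A)\<close>; a common factor 2 splits off.\<close>
  then have "sums_bdd_above (\<lambda>i. 2 * (3 * (int a + 2 * int b) * of_bool (i \<in> A) - (2 * (int a + 2 * int b) - 1)))"
  proof (rule sums_bdd_above_mono)
    show "2 * (3 * (int a + 2 * int b) * of_bool (i \<in> A) - (2 * (int a + 2 * int b) - 1)) \<le>
        (\<Sum>j<b. W1 (i + int j) - 4 * (3 * f i - 1)) + (\<Sum>j<a. W2 (i + int j) - 2 * (3 * f i - 1))" for i
      using loop[of i] unfolding sum_subtractf by (simp add: f_def algebra_simps of_bool_def)
  qed
  then show ?thesis
    by (rule sums_bdd_above_cancel) simp
qed

text \<open>At most two of the indicators at \<open>i\<close>, \<open>i + a\<close>,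
  \<open>i + a + b\<close> equal 1, and all three have the same mean.\<close>

lemma two_thirds_density_bound:
  fixes a b :: nat
  assumes "is_free {0, int a, int a + int b} A"
  shows "sums_bdd_above (\<lambda>i. 3 * of_bool (i \<in> A) - 2)"
proof (rule sums_bdd_above_mono)
  define f :: "int \<Rightarrow> int" where "f i = of_bool (i \<in> A)" for i
  have "\<bar>f i\<bar> \<le> 1" for i
    by (simp add: f_def)
  then show "sums_bdd_above (\<lambda>i. (f i - f (i + int a)) + (f i - f (i + (int a + int b))))"
    by (intro sums_bdd_above_add sums_bdd_above_shift') simp_all
  show "3 * of_bool (i \<in> A) - 2 \<le> (f i - f (i + int a)) + (f i - f (i + (int a + int b)))" for i
    using assms[unfolded is_free_triple_iff, rule_format, of i]
    by (auto simp: f_def add.assoc)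
qed

lemma upper_density_free_le:
  fixes a b :: nat
  assumes free: "is_free {0, int a, int a + int b} A" and mod: "(int a - int b) mod 3 = 2"
  defines "n \<equiv> int a + 2 * int b"
  shows "upper_density A \<le> ereal (of_int (2 * n div 3) / of_int n)"
proof -
  \<comment> \<open>\<open>n = (a - b) + 3 b\<close> has residue 2 modulo 3, so \<open>2 n\<close>
    has residue 1 and rounding down subtracts exactly 1/3.\<close>
  have n: "n > 0" "2 * n - 1 = 3 * (2 * n div 3)"
    using mod unfolding n_def by presburger+
  have "sums_bdd_above (\<lambda>i. 3 * (n * of_bool (i \<in> A) - 2 * n div 3))"
    using free_density_bound[OF free mod]
    unfolding n_def[symmetric] n(2) right_diff_distrib by (simp only: mult.assoc)
  then have "sums_bdd_above (\<lambda>i. n * of_bool (i \<in> A) - 2 * n div 3)"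
    by (rule sums_bdd_above_cancel) simp
  then show ?thesis
    using n(1) by (rule upper_density_le)
qed

section \<open>Lower bound from periodic sets\<close>

text \<open>Without wrap-around the residues are consecutive integers; otherwise the residue 0
  occurs, which 3 divides.\<close>

lemma three_dvd_mod_consecutive:
  fixes n r :: int
  assumes "n > 0"
  shows "3 dvd (r mod n) \<or> 3 dvd ((r + 1) mod n) \<or> 3 dvd ((r + 2) mod n)"
proof -
  define q where "q = r mod n"
  have q: "0 \<le> q" "q < n"
    using assms by (simp_all add: q_def)
  have r: "(r + i) mod n = (q + i) mod n" for i
    by (simp add: q_def mod_add_left_eq)
  have small: "(q + i) mod n = q + i" if "0 \<le> i" "q + i < n" for i
    using that q by simp
  have "3 dvd q \<or> 3 dvd q + 1 \<or> 3 dvd q + 2"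
    by presburger
  then consider "3 dvd q" | "3 dvd q + 1" | "3 dvd q + 2"
    by blast
  then show ?thesis
  proof cases
    case 1
    then show ?thesis by (simp add: q_def)
  next
    case 2
    consider "q + 1 < n" | "q + 1 = n"
      using q by linarith
    then show ?thesis
      using 2 r[of 1] small[of 1] by cases auto
  next
    case 3
    consider "q + 2 < n" | "q + 2 = n" | "q + 1 = n"
      using q by linarith
    then show ?thesis
      using 3 r[of 1] r[of 2] small[of 2] by cases auto
  qed
qed

lemma sum_not_3_dvd: "(\<Sum>r<n. of_bool (\<not> 3 dvd int r)) = 2 * int n div 3"
proof (induction n)
  case (Suc n)
  show ?case
    unfolding sum.lessThan_Suc Suc by (cases "3 dvd int n") (simp_all, presburger+)
qed simp

text \<open>
  Multiplication by an inverse of \<open>v\<close> modulo \<open>n\<close> turns \<open>v\<close> into the step 1, and then it suffices to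
  omit every third residue.
\<close>

lemma exists_dense_set_without_progression:
  fixes n v :: int
  assumes "n > 0" "coprime v n"
  obtains A where "\<And>s t u. \<lbrakk>s \<in> A; t \<in> A; u \<in> A; n dvd t - s - v; n dvd u - t - v\<rbrakk> \<Longrightarrow> False"
    and "ereal (of_int (2 * n div 3) / of_int n) \<le> upper_density A"
proof -
  from bezout_int[of v n] \<open>coprime v n\<close> obtain c d where cd: "c * v + d * n = 1"
    by auto
  define A where "A = {x. \<not> 3 dvd (c * x mod n)}"
  have step: "(c * t) mod n = (c * s + 1) mod n" if dvd: "n dvd t - s - v" for s t
  proof -
    from dvd obtain k where "t = s + v + n * k"
      by (metis add.commute diff_add_cancel dvdE diff_diff_eq)
    then have "c * t = c * s + 1 + n * (c * k - d)"
      using cd by (simp add: algebra_simps)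
    then show ?thesis by simp
  qed
  have "False" if "s \<in> A" "t \<in> A" "u \<in> A" "n dvd t - s - v" "n dvd u - t - v" for s t u
  proof -
    have "(c * u) mod n = (c * s + 2) mod n"
      using step[OF that(5)] step[OF that(4)] by (metis add.assoc mod_add_left_eq one_add_one)
    then show False
      using three_dvd_mod_consecutive[OF \<open>n > 0\<close>, of "c * s"] step[OF that(4)] that(1-3)
      by (auto simp: A_def)
  qed
  moreover have "ereal (of_int (2 * n div 3) / of_int n) \<le> upper_density A"
  proof (rule upper_density_ge)
    define f :: "int \<Rightarrow> int" where "f i = of_bool (i \<in> A)" for i
    \<comment> \<open>Multiplication by \<open>c\<close> permutes the residues modulo
      \<open>n\<close>, so every window of length \<open>n\<close> meets \<open>A\<close> equally
      often.\<close>
    have window: "(\<Sum>j<nat n. f (i + int j)) = 2 * n div 3" for i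
    proof -
      let ?g = "\<lambda>j. nat (c * (i + int j) mod n)"
      have inj: "inj_on ?g {..<nat n}"
      proof (rule inj_onI)
        fix j k assume jk: "j \<in> {..<nat n}" "k \<in> {..<nat n}" and "?g j = ?g k"
        then have "c * (i + int j) mod n = c * (i + int k) mod n"
          using \<open>n > 0\<close> by (simp add: nat_eq_iff)
        then have "n dvd c * (i + int j) - c * (i + int k)"
          by (simp add: mod_eq_dvd_iff)
        then have "n dvd c * (int j - int k)"
          by (simp add: algebra_simps)
        moreover have "coprime n c"
          using cd by (metis coprime_iff_gcd_eq_1 dvd_add dvd_mult dvd_mult2 gcd_dvd1 gcd_dvd2
              gcd_ge_0_int zdvd1_eq abs_of_nonneg)
        ultimately have "n dvd int j - int k"
          by (simp add: coprime_dvd_mult_right_iff)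
        then show "j = k"
          using jk zdvd_imp_le[of n "int j - int k"] zdvd_imp_le[of n "int k - int j"]
          by (cases j k rule: linorder_cases) (auto simp: dvd_diff_commute)
      qed
      moreover have "?g ` {..<nat n} \<subseteq> {..<nat n}"
        using \<open>n > 0\<close> by auto
      ultimately have "bij_betw ?g {..<nat n} {..<nat n}"
        by (simp add: bij_betw_def endo_inj_surj)
      then have "(\<Sum>j<nat n. of_bool (\<not> 3 dvd int (?g j))) = (\<Sum>r<nat n. of_bool (\<not> 3 dvd int r) :: int)"
        by (rule sum.reindex_bij_betw)
      then show ?thesis
        using \<open>n > 0\<close> by (simp add: sum_not_3_dvd f_def A_def)
    qed
    have "\<bar>f i\<bar> \<le> 1" for i
      by (simp add: f_def)
    then have "sums_bdd_above (\<lambda>i. \<Sum>j<nat n. f (i + int j) - f i)"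
      by (intro sums_bdd_above_sum sums_bdd_above_shift) simp_all
    then have "sums_bdd_above (\<lambda>i. 2 * n div 3 - n * f i)"
      using \<open>n > 0\<close> by (simp add: sum_subtractf window)
    then show "sums_bdd_above (\<lambda>i. 2 * n div 3 - n * of_bool (i \<in> A))"
      by (simp only: f_def)
  qed (fact \<open>n > 0\<close>)
  ultimately show ?thesis
    using that by blast
qed

text \<open>Modulo \<open>a + 2 b\<close> the points \<open>a, a + b, 0\<close> and
  \<open>0, - a - b, - a\<close> advance by \<open>b\<close>; modulo \<open>2 a + b\<close> the
  points \<open>a + b, 0, a\<close> and \<open>- a, 0, - a - b\<close> advance by
  \<open>a\<close>.\<close>

lemma d_f2_triple_ge:
  fixes a b n v :: int
  assumes "n > 0" "coprime v n" and v: "v = b \<and> n = a + 2 * b \<or> v = a \<and> n = 2 * a + b"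
  shows "ereal (of_int (2 * n div 3) / of_int n) \<le> d_f2 {0, a, a + b} (uminus ` {0, a, a + b})"
proof -
  obtain A where A: "\<And>s t u. \<lbrakk>s \<in> A; t \<in> A; u \<in> A; n dvd t - s - v; n dvd u - t - v\<rbrakk> \<Longrightarrow> False"
    and dens: "ereal (of_int (2 * n div 3) / of_int n) \<le> upper_density A"
    using exists_dense_set_without_progression[OF assms(1,2)] by blast
  \<comment> \<open>Each step of these progressions is \<open>v\<close> or
    \<open>v - n\<close>.\<close>
  have A': False if "s \<in> A" "t \<in> A" "u \<in> A" "t - s - v = 0 \<or> t - s - v = - n"
    "u - t - v = 0 \<or> u - t - v = - n" for s t u
    using A[OF that(1-3)] that(4,5) by auto
  have "is_free {0, a, a + b} A"
    unfolding is_free_triple_iff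
  proof (intro allI notI)
    fix t assume t: "t \<in> A \<and> t + a \<in> A \<and> t + a + b \<in> A"
    from v show False
    proof
      assume v: "v = b \<and> n = a + 2 * b"
      show False
        by (rule A'[of "t + a" "t + a + b" t]) (use t v in auto)
    next
      assume v: "v = a \<and> n = 2 * a + b"
      show False
        by (rule A'[of "t + a + b" t "t + a"]) (use t v in auto)
    qed
  qed
  moreover have "is_free (uminus ` {0, a, a + b}) A"
    unfolding is_free_uminus_triple_iff
  proof (intro allI notI)
    fix t assume t: "t \<in> A \<and> t - a \<in> A \<and> t - a - b \<in> A"
    from v show False
    proof
      assume v: "v = b \<and> n = a + 2 * b"
      show False
        by (rule A'[of t "t - a - b" "t - a"]) (use t v in auto)
    next
      assume v: "v = a \<and> n = 2 * a + b"
      show False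
        by (rule A'[of "t - a" t "t - a - b"]) (use t v in auto)
    qed
  qed
  ultimately have "upper_density A \<le> d_f2 {0, a, a + b} (uminus ` {0, a, a + b})"
    unfolding d_f2_def by (intro SUP_upper) simp
  with dens show ?thesis
    by (rule order_trans)
qed

lemma d_f2_le_d_f: "d_f2 S T \<le> d_f S"
  unfolding d_f_def d_f2_def by (rule SUP_subset_mono) auto

section \<open>Assembling the bounds by the residue of \<open>l1 - l2\<close> modulo 3\<close>

theorem theorem2:
  fixes l1 l2 :: nat and S :: "int set"
  assumes "l1 > 0" and "l2 > 0" and "coprime l1 l2"
    and "S = {0, int l1, int l1 + int l2}"
  shows "d_f2 S (uminus ` S) = d_f S \<and>
    d_f S = ereal (max
      (real_of_int \<lfloor>2 / 3 * (real l1 + 2 * real l2)\<rfloor> / (real l1 + 2 * real l2))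
      (real_of_int \<lfloor>2 / 3 * (2 * real l1 + real l2)\<rfloor> / (2 * real l1 + real l2)))"
proof -
  define n1 n2 where "n1 = int l1 + 2 * int l2" and "n2 = 2 * int l1 + int l2"
  define M where "M = max (real_of_int (2 * n1 div 3) / real_of_int n1)
      (real_of_int (2 * n2 div 3) / real_of_int n2)"
  have pos: "n1 > 0" "n2 > 0"
    using assms(1) by (simp_all add: n1_def n2_def)
  have "real l1 + 2 * real l2 = real_of_int n1" "2 * real l1 + real l2 = real_of_int n2"
    by (simp_all add: n1_def n2_def)
  moreover have "\<lfloor>2 / 3 * real_of_int n\<rfloor> = 2 * n div 3" for n
    using floor_divide_of_int_eq[of "2 * n" 3, where ?'a = real] by simp
  ultimately have M: "M = max
      (real_of_int \<lfloor>2 / 3 * (real l1 + 2 * real l2)\<rfloor> / (real l1 + 2 * real l2))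
      (real_of_int \<lfloor>2 / 3 * (2 * real l1 + real l2)\<rfloor> / (2 * real l1 + real l2))"
    by (simp only: M_def)
  have "coprime (int l1) (int l2)"
    using assms(3) by simp
  then have "coprime (int l2) n1" "coprime (int l1) n2"
    unfolding n1_def n2_def coprime_iff_gcd_eq_1
    using gcd_add_mult[of "int l2" 2 "int l1"] gcd_add_mult[of "int l1" 2 "int l2"]
    by (simp_all add: gcd.commute add.commute)
  then have "ereal M \<le> d_f2 S (uminus ` S)"
    using d_f2_triple_ge[of n1 "int l2" "int l2" "int l1"]
      d_f2_triple_ge[of n2 "int l1" "int l2" "int l1"] pos
    unfolding assms(4) M_def max_def by (simp add: n1_def n2_def)
  moreover have "d_f S \<le> ereal M"
    unfolding d_f_def
  proof (rule SUP_least)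
    fix A assume "A \<in> {A. is_free S A}"
    then have free: "is_free {0, int l1, int l1 + int l2} A"
      by (simp add: assms(4))
    have "(int l1 - int l2) mod 3 = 0 \<or> (int l1 - int l2) mod 3 = 2 \<or> (int l2 - int l1) mod 3 = 2"
      by presburger
    then show "upper_density A \<le> ereal M"
    proof (elim disjE)
      \<comment> \<open>Here 3 divides \<open>n1 = (l1 - l2) + 3 l2\<close>, so the first fraction
        is exactly 2/3.\<close>
      assume "(int l1 - int l2) mod 3 = 0"
      then have "2 * n1 = 3 * (2 * n1 div 3)"
        unfolding n1_def by presburger
      then have "2 * real_of_int n1 = 3 * real_of_int (2 * n1 div 3)"
        by linarith
      then have "2 / 3 = real_of_int (2 * n1 div 3) / real_of_int n1"
        using pos by (simp add: field_simps)
      then have "2 / 3 \<le> M"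
        by (simp only: M_def max.cobounded1)
      then show ?thesis
        using upper_density_le[OF two_thirds_density_bound[OF free]]
        by (auto intro: order_trans)
    next
      assume "(int l1 - int l2) mod 3 = 2"
      from upper_density_free_le[OF free this] show ?thesis
        unfolding n1_def[symmetric] by (rule order_trans) (simp add: M_def)
    next
      \<comment> \<open>Reflection swaps \<open>l1\<close> and \<open>l2\<close>, which turns the
        modulus into \<open>n2\<close>.\<close>
      assume "(int l2 - int l1) mod 3 = 2"
      from upper_density_free_le[OF is_free_triple_reflect[OF free] this] show ?thesis
        unfolding upper_density_uminus n2_def[symmetric] add.commute[of "int l2"]
        by (rule order_trans) (simp add: M_def)
    qed
  qed
  \<comment> \<open>The chain \<open>M \<le> d_f2 \<le> d_f \<le> M\<close> forces equality
    throughout.\<close>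
  ultimately show ?thesis
    unfolding M[symmetric] using d_f2_le_d_f[of S "uminus ` S"] by (meson antisym order_trans)
qed

end
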